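(* Let $G$ be a graph and let $c$ be a real constant satisfying $0<c<2/3$. For every $v\in V(G)$, let integers $a_v^-,a_v^+$ be given such that $a_v^-\le c\,d(v)\le a_v^+<d(v)$ and $$a_v^+\le \min\left\{c\,d(v)+(1-c)a_v^-+1,\ \frac{a_v^-+1}{c}+1\right\}.$$ Let $L(v)=\{a_v^-,\,a_v^-+1,\,a_v^+,\,a_v^++1\}$ for every $v\in V(G)$. Then $G$ contains an $L$-factor.
   Context: All graphs are finite, undirected and simple; $d(v)$ denotes the degree of $v$ in $G$. Let $L:V(G)\to 2^{\mathbb N}$ be a function assigning to each vertex a set of nonnegative integers. An $L$-factor of $G$ is a spanning subgraph $H$ of $G$ such that $d_H(v)\in L(v)$ for all $v\in V(G)$. *)

theory Defs
  imports Complex_Main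
begin

(* A graph is a pair of a vertex set and an edge set; an edge is a two-element set of vertices. *)
type_synonym 'a graph = "'a set \<times> 'a set set"

abbreviation verts :: "'a graph \<Rightarrow> 'a set" where
  "verts G \<equiv> fst G"

abbreviation edges :: "'a graph \<Rightarrow> 'a set set" where
  "edges G \<equiv> snd G"

definition finite_simple_graph :: "'a graph \<Rightarrow> bool" where
  "finite_simple_graph G \<longleftrightarrow>
     finite (verts G) \<and> (\<forall>e\<in>edges G. e \<subseteq> verts G \<and> card e = 2)"

definition degree :: "'a graph \<Rightarrow> 'a \<Rightarrow> nat" where
  "degree G v = card {e \<in> edges G. v \<in> e}"

definition spanning_subgraph :: "'a graph \<Rightarrow> 'a graph \<Rightarrow> bool" where
  "spanning_subgraph H G \<longleftrightarrow>
     finite_simple_graph H \<and> verts H = verts G \<and> edges H \<subseteq> edges G"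

definition L_factor :: "'a graph \<Rightarrow> ('a \<Rightarrow> nat set) \<Rightarrow> 'a graph \<Rightarrow> bool" where
  "L_factor G L H \<longleftrightarrow>
     spanning_subgraph H G \<and> (\<forall>v\<in>verts G. degree H v \<in> L v)"

end

theory Submission
  imports Defs
begin

text \<open>
  Give every vertex a target \<open>\<sigma> v\<close>, one of \<open>am v\<close> and \<open>ap v\<close>, and look for a subgraph \<open>H\<close> in
  which every degree is \<open>\<sigma> v\<close> or \<open>\<sigma> v + 1\<close>. Demand the upper bound always, and call the total
  amount by which degrees fall short of their targets the deficiency. Over all pairs \<open>(\<sigma>, H)\<close>,
  minimise first the deficiency and then the number of vertices whose target is not \<open>am v\<close>. If the
  minimum deficiency is 0, then \<open>H\<close> is the required factor.

  Otherwise follow paths from deficient vertices that use alternately an edge outside \<open>H\<close> and an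
  edge of \<open>H\<close>. Let \<open>A\<close> be the set of vertices reached after an even and \<open>B\<close> after an odd number of
  steps. Exchanging the edges of such a path changes degrees at its two ends only, so minimality
  forces degree at most \<open>\<sigma> v\<close> on \<open>A\<close> and exactly \<open>\<sigma> v + 1\<close> on \<open>B\<close>. Hence \<open>A\<close> and \<open>B\<close> are disjoint.
  Moreover, all edges between \<open>A\<close> and the complement of \<open>B\<close> lie in \<open>H\<close>, and all edges of \<open>H\<close> at
  \<open>B\<close> lead to \<open>A\<close>. With \<open>K\<close> the set of all edges between \<open>A\<close> and \<open>B\<close>, and \<open>q v\<close> the number of
  edges at \<open>v\<close> outside \<open>K\<close>, counting \<open>H \<inter> K\<close> from both sides shows (\<open>deficient_balance\<close>)
  that the sum of \<open>\<sigma> v + 1\<close> over \<open>B\<close> is less than the sum of \<open>\<sigma> v - q v\<close> over \<open>A\<close>.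

  The hypotheses contradict this, because the first sum is at least, and the second at most, \<open>c\<close>
  times the number of edges of \<open>K\<close>: each \<open>v\<close> in \<open>B\<close> has \<open>\<sigma> v + 1 \<ge> c * deg K v\<close>, and each \<open>v\<close> in \<open>A\<close> has
  \<open>\<sigma> v - q v \<le> c * deg K v\<close>. For a target \<open>ap v\<close> in \<open>B\<close> or \<open>am v\<close> in \<open>A\<close> this is immediate from
  \<open>am v \<le> c * d v \<le> ap v\<close>. The other two cases use minimality over the targets.

  If \<open>v\<close> in \<open>B\<close> has target \<open>am v < ap v\<close> and at least \<open>ap v\<close> edges to \<open>A\<close>, then an exchange along
  a path to \<open>v\<close> followed by adding edges from \<open>v\<close> to \<open>A\<close> makes the target \<open>ap v\<close> feasible and
  lowers the deficiency (\<open>raise_target\<close>). So \<open>deg K v \<le> ap v - 1\<close>, and the second bound on \<open>ap v\<close>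
  applies.

  If \<open>v\<close> in \<open>A\<close> has target \<open>ap v > am v\<close> and \<open>q v \<le> am v + 2\<close>, then deleting edges from \<open>v\<close> to
  \<open>B\<close>, and possibly one further edge, makes the target \<open>am v\<close> feasible without raising the
  deficiency (\<open>lower_target\<close>), against the choice of the pair. So \<open>q v \<ge> am v + 3\<close>, and the first
  bound on \<open>ap v\<close> gives \<open>ap v - q v \<le> c * deg K v + 1 - 3 * (1 - c)\<close>. This is where \<open>c < 2/3\<close>
  enters.
\<close>

section \<open>Degrees in edge sets\<close>

definition deg :: "'a set set \<Rightarrow> 'a \<Rightarrow> nat" where
  "deg F v = card {e \<in> F. v \<in> e}"

lemma deg_mono: "F \<subseteq> F' \<Longrightarrow> finite F' \<Longrightarrow> deg F v \<le> deg F' v"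
  unfolding deg_def by (rule card_mono) auto

lemma deg_Un_disjoint:
  assumes "finite F" "finite D" "F \<inter> D = {}"
  shows "deg (F \<union> D) v = deg F v + deg D v"
proof -
  have "{e \<in> F \<union> D. v \<in> e} = {e \<in> F. v \<in> e} \<union> {e \<in> D. v \<in> e}" by auto
  then show ?thesis
    unfolding deg_def using assms by (simp, intro card_Un_disjoint) auto
qed

lemma deg_Diff:
  assumes "finite F" "D \<subseteq> F"
  shows "deg (F - D) v + deg D v = deg F v"
  using deg_Un_disjoint[of "F - D" D v] assms finite_subset[OF assms(2,1)]
  by (simp add: Un_absorb2 Diff_disjoint[THEN trans[OF Int_commute]])

lemma deg_singleton: "deg {e} v = of_bool (v \<in> e)"
proof -
  have "{e'. e' = e \<and> v \<in> e'} = (if v \<in> e then {e} else {})" by auto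
  then show ?thesis by (simp add: deg_def)
qed

lemma deg_star_centre: "(\<And>e. e \<in> D \<Longrightarrow> v \<in> e) \<Longrightarrow> deg D v = card D"
  unfolding deg_def by (rule arg_cong[of _ _ card]) auto

lemma deg_star_leaf:
  assumes "\<And>e. e \<in> D \<Longrightarrow> v \<in> e \<and> card e = 2" and "u \<noteq> v"
  shows "deg D u = of_bool ({v, u} \<in> D)"
proof -
  have "e = {v, u}" if "e \<in> D" "u \<in> e" for e
  proof -
    have "card e = 2" "v \<in> e" using assms(1) that by auto
    then obtain a b where "e = {a, b}" by (meson card_2_iff)
    then show ?thesis using \<open>v \<in> e\<close> that(2) assms(2) by auto
  qed
  then have "e \<in> D \<and> u \<in> e \<longleftrightarrow> {v, u} \<in> D \<and> e = {v, u}" for e by blast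
  then have "{e \<in> D. u \<in> e} = (if {v, u} \<in> D then {{v, u}} else {})" by simp
  then show ?thesis by (simp add: deg_def)
qed

lemma sum_deg_eq_card:
  assumes "finite K" "finite A" and "\<And>e. e \<in> K \<Longrightarrow> card (A \<inter> e) = 1"
  shows "(\<Sum>v\<in>A. deg K v) = card K"
proof -
  have "deg K v = (\<Sum>e\<in>K. of_bool (v \<in> e))" for v
    using assms(1) by (simp add: deg_def sum.If_cases of_bool_def Int_def)
  then have "(\<Sum>v\<in>A. deg K v) = (\<Sum>v\<in>A. \<Sum>e\<in>K. of_bool (v \<in> e))" by simp
  also have "\<dots> = (\<Sum>e\<in>K. \<Sum>v\<in>A. of_bool (v \<in> e))" by (rule sum.swap)
  also have "\<dots> = (\<Sum>e\<in>K. card (A \<inter> e))"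
    using assms(2) by (simp add: sum.If_cases of_bool_def Int_def)
  also have "\<dots> = card K" using assms(3) by simp
  finally show ?thesis .
qed


section \<open>Subgraphs of minimum deficiency\<close>

text \<open>
  The target \<open>\<sigma> v\<close> stands for the pair \<open>{\<sigma> v, \<sigma> v + 1}\<close>. Having two consecutive values is what
  makes parity harmless: a vertex at the lower value can gain an edge and one at the upper value can
  lose one, so no blossoms have to be contracted.
\<close>

definition capped :: "'a set \<Rightarrow> ('a \<Rightarrow> int) \<Rightarrow> 'a set set \<Rightarrow> bool" where
  "capped V \<sigma> H \<longleftrightarrow> (\<forall>v\<in>V. int (deg H v) \<le> \<sigma> v + 1)"

definition deficiency :: "'a set \<Rightarrow> ('a \<Rightarrow> int) \<Rightarrow> 'a set set \<Rightarrow> nat" where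
  "deficiency V \<sigma> H = (\<Sum>v\<in>V. nat (\<sigma> v - int (deg H v)))"

locale min_deficiency =
  fixes V :: "'a set" and E H :: "'a set set" and \<sigma> :: "'a \<Rightarrow> int"
  assumes finite_V: "finite V"
    and edge_sub: "e \<in> E \<Longrightarrow> e \<subseteq> V"
    and edge_card: "e \<in> E \<Longrightarrow> card e = 2"
    and H_sub: "H \<subseteq> E"
    and H_capped: "capped V \<sigma> H"
    and H_min: "\<lbrakk>H' \<subseteq> E; capped V \<sigma> H'\<rbrakk> \<Longrightarrow> deficiency V \<sigma> H \<le> deficiency V \<sigma> H'"
begin

lemma finite_E: "finite E"
  by (rule finite_subset[of _ "Pow V"]) (use edge_sub finite_V in auto)

lemma finite_sub_E: "F \<subseteq> E \<Longrightarrow> finite F"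
  using finite_E finite_subset by blast

lemma edge_distinct: "{v, w} \<in> E \<Longrightarrow> v \<noteq> w"
  using edge_card by fastforce

text \<open>
  The shape of the degree change is that of an exchange along an alternating trail from a deficient
  vertex \<open>x\<close> to \<open>w\<close>. The case \<open>w = x\<close> with \<open>\<delta> = 1\<close> is included: the degree of \<open>x\<close> then rises by two,
  which the cap permits because \<open>x\<close> starts below its target.
\<close>

lemma no_gain:
  assumes H': "H' \<subseteq> E" and x: "x \<in> V" "int (deg H x) < \<sigma> x"
    and d: "\<And>u. int (deg H' u) = int (deg H u) + of_bool (u = x) + \<delta> * of_bool (u = w)"
    and w: "\<delta> = 1 \<and> int (deg H w) \<le> \<sigma> w \<or> \<delta> = - 1 \<and> int (deg H w) = \<sigma> w + 1"
  shows False
proof -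
  have cap: "int (deg H u) \<le> \<sigma> u + 1" if "u \<in> V" for u
    using H_capped that by (auto simp: capped_def)
  have "int (deg H' u) \<le> \<sigma> u + 1" if "u \<in> V" for u
    using cap[OF that] d[of u] w x(2) by (cases "u = x"; cases "u = w") auto
  then have capped: "capped V \<sigma> H'" by (simp add: capped_def)
  have "nat (\<sigma> u - int (deg H' u)) \<le> nat (\<sigma> u - int (deg H u))" for u
    using d[of u] w x(2) by (cases "u = x"; cases "u = w") auto
  moreover have "nat (\<sigma> x - int (deg H' x)) < nat (\<sigma> x - int (deg H x))"
    using d[of x] w x(2) by (cases "x = w") auto
  ultimately have "deficiency V \<sigma> H' < deficiency V \<sigma> H"
    unfolding deficiency_def using finite_V x(1)
    by (intro sum_strict_mono_ex1) auto
  then show False using H_min[OF H' capped] by simp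
qed

text \<open>
  In \<open>alt_path x F S T v b\<close>, the path runs from the deficient vertex \<open>x\<close> to \<open>v\<close> with edge set \<open>F\<close>;
  \<open>S\<close> and \<open>T\<close> are the vertices at even and odd distance along it, and \<open>b\<close> says that its length is
  even. Paths never revisit a vertex, which makes the degree change of an exchange easy to compute;
  that the sets of end points are nevertheless closed under alternating steps is shown in
  \<open>A_closed\<close> and \<open>B_closed\<close>.
\<close>

inductive alt_path ::
  "'a \<Rightarrow> 'a set set \<Rightarrow> 'a set \<Rightarrow> 'a set \<Rightarrow> 'a \<Rightarrow> bool \<Rightarrow> bool" where
  start: "\<lbrakk>x \<in> V; int (deg H x) < \<sigma> x\<rbrakk> \<Longrightarrow> alt_path x {} {x} {} x True"
| fwd: "\<lbrakk>alt_path x F S T v True; {v, w} \<in> E; {v, w} \<notin> H; w \<notin> S \<union> T\<rbrakk>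
    \<Longrightarrow> alt_path x (insert {v, w} F) S (insert w T) w False"
| bwd: "\<lbrakk>alt_path x F S T v False; {v, w} \<in> H; w \<notin> S \<union> T\<rbrakk>
    \<Longrightarrow> alt_path x (insert {v, w} F) (insert w S) T w True"

definition A :: "'a set" where "A = {v. \<exists>x F S T. alt_path x F S T v True}"

definition B :: "'a set" where "B = {v. \<exists>x F S T. alt_path x F S T v False}"

lemma alt_path_invariants:
  assumes "alt_path x F S T v b"
  shows "S \<inter> T = {}" "x \<in> S" "F \<subseteq> E" "v \<in> (if b then S else T)"
    "\<forall>e\<in>F. \<exists>s\<in>S. \<exists>t\<in>T. e = {s, t}" "S \<subseteq> V" "T \<subseteq> V"
    "x \<in> V" "int (deg H x) < \<sigma> x"
proof -
  have "S \<inter> T = {} \<and> x \<in> S \<and> F \<subseteq> E \<and> v \<in> (if b then S else T) \<and>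
    (\<forall>e\<in>F. \<exists>s\<in>S. \<exists>t\<in>T. e = {s, t}) \<and> S \<subseteq> V \<and> T \<subseteq> V \<and>
    x \<in> V \<and> int (deg H x) < \<sigma> x"
    using assms
  proof (induction rule: alt_path.induct)
    case (start x)
    then show ?case by simp
  next
    case (fwd x F S T v w)
    have "v \<in> S" "\<forall>e\<in>F. \<exists>s\<in>S. \<exists>t\<in>T. e = {s, t}" using fwd.IH by simp_all
    then have "\<forall>e\<in>insert {v, w} F. \<exists>s\<in>S. \<exists>t\<in>insert w T. e = {s, t}"
      by (metis insert_iff)
    moreover have "w \<in> V" using edge_sub[OF fwd.hyps(2)] by simp
    ultimately show ?case using fwd by simp
  next
    case (bwd x F S T v w)
    have e: "{v, w} \<in> E" using bwd.hyps(2) H_sub by blast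
    have "v \<in> T" "\<forall>e\<in>F. \<exists>s\<in>S. \<exists>t\<in>T. e = {s, t}" using bwd.IH by simp_all
    then have "\<forall>e\<in>insert {v, w} F. \<exists>s\<in>insert w S. \<exists>t\<in>T. e = {s, t}"
      by (metis insert_iff insert_commute)
    moreover have "w \<in> V" using edge_sub[OF e] by simp
    ultimately show ?case using bwd e by simp
  qed
  then show "S \<inter> T = {}" "x \<in> S" "F \<subseteq> E" "v \<in> (if b then S else T)"
    "\<forall>e\<in>F. \<exists>s\<in>S. \<exists>t\<in>T. e = {s, t}" "S \<subseteq> V" "T \<subseteq> V"
    "x \<in> V" "int (deg H x) < \<sigma> x" by blast+
qed

lemma alt_path_visited:
  assumes "alt_path x F S T v b"
  shows "S \<subseteq> A \<and> T \<subseteq> B"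
  using assms
proof (induction rule: alt_path.induct)
  case (start x) then show ?case unfolding A_def using alt_path.start[OF start] by blast
next
  case (fwd x F S T v w)
  have "w \<in> B" unfolding B_def using alt_path.fwd[OF fwd.hyps] by blast
  then show ?case using fwd.IH by simp
next
  case (bwd x F S T v w)
  have "w \<in> A" unfolding A_def using alt_path.bwd[OF bwd.hyps] by blast
  then show ?case using bwd.IH by simp
qed

lemma alt_path_edge_sub:
  assumes "alt_path x F S T v b" "e \<in> F"
  shows "e \<subseteq> S \<union> T"
proof -
  obtain s t where "s \<in> S" "t \<in> T" "e = {s, t}"
    using alt_path_invariants(5)[OF assms(1)] assms(2) by blast
  then show ?thesis by simp
qed

definition flip :: "'a set set \<Rightarrow> 'a set set" where
  "flip F = (H - F) \<union> (F - H)"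

lemma flip_sub: "F \<subseteq> E \<Longrightarrow> flip F \<subseteq> E"
  using H_sub by (auto simp: flip_def)

lemma deg_flip_insert:
  assumes "F \<subseteq> E" "e \<in> E" "e \<notin> F"
  shows "int (deg (flip (insert e F)) u) =
    int (deg (flip F) u) + (if e \<in> H then - 1 else 1) * of_bool (u \<in> e)"
proof (cases "e \<in> H")
  case True
  then have "flip (insert e F) = flip F - {e}" "e \<in> flip F"
    using assms(3) by (auto simp: flip_def)
  then show ?thesis
    using deg_Diff[of "flip F" "{e}" u] finite_sub_E[OF flip_sub[OF assms(1)]] True
    by (cases "u \<in> e") (auto simp: deg_singleton)
next
  case False
  then have "flip (insert e F) = flip F \<union> {e}" "e \<notin> flip F"
    using assms(3) by (auto simp: flip_def)
  then show ?thesis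
    using deg_Un_disjoint[of "flip F" "{e}" u] finite_sub_E[OF flip_sub[OF assms(1)]] False
    by (cases "u \<in> e") (auto simp: deg_singleton)
qed

text \<open>
  At an inner vertex, one of the two path edges enters \<open>H\<close> and the other leaves it, so only the ends
  change. For the trivial path, the two contributions at \<open>x = v\<close> cancel.
\<close>

lemma alt_path_deg_flip:
  assumes "alt_path x F S T v b"
  shows "int (deg (flip F) u) =
    int (deg H u) + of_bool (u = x) + (if b then - 1 else 1) * of_bool (u = v)"
  using assms
proof (induction rule: alt_path.induct)
  case (start x)
  then show ?case by (simp add: flip_def)
next
  case (fwd x F S T v w)
  note inv = alt_path_invariants[OF fwd.hyps(1)]
  have "{v, w} \<notin> F" using alt_path_edge_sub[OF fwd.hyps(1)] fwd.hyps(4) by blast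
  then show ?case
    using deg_flip_insert[OF inv(3) fwd.hyps(2), of u] fwd.IH fwd.hyps(3)
      edge_distinct[OF fwd.hyps(2)] by auto
next
  case (bwd x F S T v w)
  note inv = alt_path_invariants[OF bwd.hyps(1)]
  have e: "{v, w} \<in> E" using bwd.hyps(2) H_sub by auto
  have "{v, w} \<notin> F" using alt_path_edge_sub[OF bwd.hyps(1)] bwd.hyps(3) by blast
  then show ?case
    using deg_flip_insert[OF inv(3) e, of u] bwd.IH bwd.hyps(2)
      edge_distinct[OF e] by auto
qed

lemma A_sub: "A \<subseteq> V"
proof
  fix v assume "v \<in> A"
  then obtain x F S T where p: "alt_path x F S T v True" by (auto simp: A_def)
  show "v \<in> V" using alt_path_invariants(4,6)[OF p] by auto
qed

lemma B_sub: "B \<subseteq> V"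
proof
  fix v assume "v \<in> B"
  then obtain x F S T where p: "alt_path x F S T v False" by (auto simp: B_def)
  show "v \<in> V" using alt_path_invariants(4,7)[OF p] by auto
qed

text \<open>
  If \<open>v\<close> were above its target, then exchanging a path to \<open>v\<close> would take one edge from \<open>v\<close>, which
  \<open>v\<close> can spare, and give one to the deficient start.
\<close>

lemma A_deg_le:
  assumes "v \<in> A" shows "int (deg H v) \<le> \<sigma> v"
proof (rule ccontr)
  assume neg: "\<not> ?thesis"
  obtain x F S T where p: "alt_path x F S T v True" using assms by (auto simp: A_def)
  note inv = alt_path_invariants[OF p]
  have "int (deg H v) \<le> \<sigma> v + 1"
    using H_capped assms A_sub by (auto simp: capped_def)
  then show False
    using no_gain[OF flip_sub[OF inv(3)] inv(8,9), of "- 1" v] alt_path_deg_flip[OF p] neg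
    by simp
qed

text \<open>
  If \<open>v\<close> had room for one more edge, then exchanging a path to \<open>v\<close> would serve the deficient start.
\<close>

lemma B_deg_eq:
  assumes "v \<in> B" shows "int (deg H v) = \<sigma> v + 1"
proof (rule ccontr)
  assume neg: "\<not> ?thesis"
  obtain x F S T where p: "alt_path x F S T v False" using assms by (auto simp: B_def)
  note inv = alt_path_invariants[OF p]
  have "int (deg H v) \<le> \<sigma> v + 1"
    using H_capped assms B_sub by (auto simp: capped_def)
  then show False
    using no_gain[OF flip_sub[OF inv(3)] inv(8,9), of 1 v] alt_path_deg_flip[OF p] neg
    by simp
qed

lemma A_B_disjoint: "A \<inter> B = {}"
  using A_deg_le B_deg_eq by force

text \<open>
  Either the path to \<open>v\<close> extends to \<open>w\<close>, or it already visits \<open>w\<close> at an odd place, or it visits \<open>w\<close>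
  at an even place. In the last case the path together with the edge \<open>{v, w}\<close> is a trail ending in an
  odd cycle, and exchanging it gives \<open>w\<close> an additional edge. There is room for that edge since \<open>w\<close>
  belongs to \<open>A\<close>.
\<close>

lemma A_closed:
  assumes "v \<in> A" "{v, w} \<in> E" "{v, w} \<notin> H"
  shows "w \<in> B"
proof -
  obtain x F S T where p: "alt_path x F S T v True" using assms(1) by (auto simp: A_def)
  note inv = alt_path_invariants[OF p] and d = alt_path_deg_flip[OF p]
  consider "w \<notin> S \<union> T" | "w \<in> T" | "w \<in> S" by auto
  then show ?thesis
  proof cases
    case 1
    then show ?thesis unfolding B_def using fwd[OF p assms(2,3)] by blast
  next
    case 2
    then show ?thesis using alt_path_visited[OF p] by auto
  next
    case 3
    have "{v, w} \<notin> F"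
    proof
      assume "{v, w} \<in> F"
      then obtain s t where "s \<in> S" "t \<in> T" "{v, w} = {s, t}" using inv(5) by blast
      then show False using inv(1,4) 3 by (auto simp: doubleton_eq_iff)
    qed
    then have d': "int (deg (flip (insert {v, w} F)) u) =
        int (deg H u) + of_bool (u = x) + of_bool (u = w)" for u
      using deg_flip_insert[OF inv(3) assms(2), of u] d[of u] assms(3)
        edge_distinct[OF assms(2)] by auto
    have "int (deg H w) \<le> \<sigma> w" using A_deg_le alt_path_visited[OF p] 3 by auto
    then have False
      using no_gain[OF flip_sub[of "insert {v, w} F"] inv(8,9), of 1 w] d' inv(3) assms(2)
      by simp
    then show ?thesis ..
  qed
qed

text \<open>
  As for \<open>A_closed\<close>. Here the odd cycle closes at a vertex \<open>w\<close> of \<open>B\<close>, which loses an edge in the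
  exchange and can spare it.
\<close>

lemma B_closed:
  assumes "v \<in> B" "{v, w} \<in> H"
  shows "w \<in> A"
proof -
  obtain x F S T where p: "alt_path x F S T v False" using assms(1) by (auto simp: B_def)
  note inv = alt_path_invariants[OF p] and d = alt_path_deg_flip[OF p]
  have e: "{v, w} \<in> E" using assms(2) H_sub by auto
  consider "w \<notin> S \<union> T" | "w \<in> S" | "w \<in> T" by auto
  then show ?thesis
  proof cases
    case 1
    then show ?thesis unfolding A_def using bwd[OF p assms(2)] by blast
  next
    case 2
    then show ?thesis using alt_path_visited[OF p] by auto
  next
    case 3
    have "{v, w} \<notin> F"
    proof
      assume "{v, w} \<in> F"
      then obtain s t where "s \<in> S" "t \<in> T" "{v, w} = {s, t}" using inv(5) by blast
      then show False using inv(1,4) 3 by (auto simp: doubleton_eq_iff)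
    qed
    then have d': "int (deg (flip (insert {v, w} F)) u) =
        int (deg H u) + of_bool (u = x) - of_bool (u = w)" for u
      using deg_flip_insert[OF inv(3) e, of u] d[of u] assms(2)
        edge_distinct[OF e] by auto
    have "int (deg H w) = \<sigma> w + 1" using B_deg_eq alt_path_visited[OF p] 3 by auto
    then have False
      using no_gain[OF flip_sub[of "insert {v, w} F"] inv(8,9), of "- 1" w] d' inv(3) e
      by simp
    then show ?thesis ..
  qed
qed

text \<open>
  One unit of deficiency can be moved from its place to any chosen vertex of \<open>A\<close>.
\<close>

lemma shift_to_A:
  assumes "v \<in> A"
  obtains x H' where "x \<in> A" "int (deg H x) < \<sigma> x" "H' \<subseteq> E"
    "\<And>u. int (deg H' u) = int (deg H u) + of_bool (u = x) - of_bool (u = v)"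
proof -
  obtain x F S T where p: "alt_path x F S T v True" using assms by (auto simp: A_def)
  note inv = alt_path_invariants[OF p]
  show ?thesis
    by (rule that[of x "flip F"])
      (use inv alt_path_deg_flip[OF p] alt_path_visited[OF p] flip_sub in auto)
qed

text \<open>
  One unit of deficiency can be removed at the price of one unit of excess over the cap at any chosen
  vertex of \<open>B\<close>.
\<close>

lemma shift_to_B:
  assumes "v \<in> B"
  obtains x H' where "x \<in> A" "int (deg H x) < \<sigma> x" "H' \<subseteq> E"
    "\<And>u. int (deg H' u) = int (deg H u) + of_bool (u = x) + of_bool (u = v)"
proof -
  obtain x F S T where p: "alt_path x F S T v False" using assms by (auto simp: B_def)
  note inv = alt_path_invariants[OF p]
  show ?thesis
    by (rule that[of x "flip F"])
      (use inv alt_path_deg_flip[OF p] alt_path_visited[OF p] flip_sub in auto)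
qed

definition K :: "'a set set" where
  "K = {e \<in> E. e \<inter> A \<noteq> {} \<and> e \<inter> B \<noteq> {}}"

lemma K_sub: "K \<subseteq> E"
  by (auto simp: K_def)

lemma edge_at:
  assumes "e \<in> E" "v \<in> e"
  obtains w where "e = {v, w}" "w \<noteq> v"
proof -
  obtain a b where "e = {a, b}" "a \<noteq> b" using edge_card[OF assms(1)] by (meson card_2_iff)
  then show ?thesis using assms(2) that by auto
qed

lemma K_ends: "e \<in> K \<Longrightarrow> card (A \<inter> e) = 1 \<and> card (B \<inter> e) = 1"
proof -
  assume "e \<in> K"
  then obtain a b where ab: "a \<in> A" "b \<in> B" "a \<in> e" "b \<in> e" "e \<in> E" by (auto simp: K_def)
  then have "e = {a, b}" using A_B_disjoint by (auto elim!: edge_at[of e a])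
  then have "A \<inter> e = {a}" "B \<inter> e = {b}" using ab A_B_disjoint by auto
  then show ?thesis by simp
qed

lemma sum_deg_K:
  assumes "K' \<subseteq> K"
  shows "(\<Sum>v\<in>A. deg K' v) = card K'" "(\<Sum>v\<in>B. deg K' v) = card K'"
  using assms K_ends K_sub A_sub B_sub finite_V finite_subset
  by (blast intro!: sum_deg_eq_card finite_sub_E)+


section \<open>Changing one target\<close>

text \<open>
  First move a unit of deficiency from a vertex \<open>x\<close> to \<open>v\<close>, which brings the degree of \<open>v\<close> below
  \<open>\<sigma> v\<close>. Since \<open>l < \<sigma> v\<close>, the new target no longer charges this unit, and so one unit is gained. To get the degree of \<open>v\<close> down to
  \<open>l + 1\<close>, delete edges from \<open>v\<close> to \<open>B\<close>; these are free, because the vertices of \<open>B\<close> have degree one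
  above target. Since at most \<open>l + 2\<close> edges at \<open>v\<close> do not lead to \<open>B\<close>, at most one other edge has to
  go, and its far end \<open>w\<close> loses at most the unit that was gained.
\<close>

lemma lower_target:
  assumes v: "v \<in> A" and l: "l < \<sigma> v" "- 1 \<le> l" and few: "int (deg (E - K) v) \<le> l + 2"
  shows "\<exists>H'. H' \<subseteq> E \<and> capped V (\<sigma>(v := l)) H' \<and>
    deficiency V (\<sigma>(v := l)) H' \<le> deficiency V \<sigma> H"
proof -
  obtain x H' where x: "x \<in> A" "int (deg H x) < \<sigma> x" and H': "H' \<subseteq> E"
    and d: "\<And>u. int (deg H' u) = int (deg H u) + of_bool (u = x) - of_bool (u = v)"
    using shift_to_A[OF v] by blast
  have fin: "finite H'" using H' by (rule finite_sub_E)
  define R where "R = {e \<in> H' \<inter> K. v \<in> e}"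
  define Q where "Q = {e \<in> H' - K. v \<in> e}"
  have degQ: "deg (H' - K) v = card Q" by (simp add: deg_def Q_def)
  have degH': "deg H' v = card R + card Q"
    using deg_Diff[of H' "H' \<inter> K" v] fin degQ
    by (simp add: Diff_Int deg_def R_def)
  have "card Q \<le> deg (E - K) v"
    unfolding degQ[symmetric] by (rule deg_mono) (use H' finite_E in auto)
  then have cardR: "int (deg H' v) - (l + 2) \<le> int (card R)" using degH' few by linarith
  have finR: "finite R" using fin by (auto simp: R_def)
  have RB: "u \<in> B" if "{v, u} \<in> R" for u
    using that v A_B_disjoint by (auto simp: R_def K_def)
  (* If Q is empty, no edge outside K is deleted, and w is a dummy value. *)
  obtain R' w where R': "R' \<subseteq> H'" "\<And>e. e \<in> R' \<Longrightarrow> v \<in> e"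
      "\<And>u. {v, u} \<in> R' \<Longrightarrow> u \<in> B \<or> u = w"
      "int (deg H' v) - (l + 1) \<le> int (card R')"
  proof (cases "Q = {}")
    case True
    show ?thesis
    proof (rule that[of R v])
      show "int (deg H' v) - (l + 1) \<le> int (card R)"
        using True degH' l(2) by simp
    qed (use RB in \<open>auto simp: R_def\<close>)
  next
    case False
    then obtain e0 where e0: "e0 \<in> Q" by blast
    then have "e0 \<in> E" "v \<in> e0" using H' by (auto simp: Q_def)
    then obtain w where w: "e0 = {v, w}" by (rule edge_at)
    have "e0 \<notin> R" using e0 by (simp add: Q_def R_def)
    then have "card (insert e0 R) = card R + 1" using finR by simp
    then show ?thesis
    proof (intro that[of "insert e0 R" w])
      show "u \<in> B \<or> u = w" if "{v, u} \<in> insert e0 R" for u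
        using that RB w by (auto simp: doubleton_eq_iff)
    qed (use e0 cardR in \<open>auto simp: R_def Q_def\<close>)
  qed
  have "nat (int (deg H' v) - (l + 1)) \<le> card R'" using R'(4) by linarith
  then obtain D where D: "D \<subseteq> R'" "card D = nat (int (deg H' v) - (l + 1))"
    by (rule obtain_subset_with_card_n)
  have DH: "D \<subseteq> H'" using D R' by auto
  have star: "e \<in> D \<Longrightarrow> v \<in> e \<and> card e = 2" for e
    using D R' H' edge_card by blast
  define H'' where "H'' = H' - D"
  have d2: "int (deg H'' u) = int (deg H' u) - int (deg D u)" for u
    using deg_Diff[OF fin DH, of u] by (simp add: H''_def)
  have dv: "int (deg H'' v) = min (int (deg H' v)) (l + 1)"
    using d2[of v] deg_star_centre[of D v] star D(2) by auto
  have du: "int (deg D u) = of_bool ({v, u} \<in> D)" if "u \<noteq> v" for u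
    using deg_star_leaf[of D v u] star that by auto
  have out: "{v, u} \<in> D \<Longrightarrow> u \<in> B \<or> u = w" for u using D(1) R'(3) by blast
  let ?\<tau> = "\<sigma>(v := l)"
  have xB: "x \<notin> B" "v \<notin> B" using x v A_B_disjoint by auto
  have cap: "\<And>u. u \<in> V \<Longrightarrow> int (deg H u) \<le> \<sigma> u + 1"
    using H_capped by (auto simp: capped_def)
  have "int (deg H'' u) \<le> ?\<tau> u + 1" if "u \<in> V" for u
    using cap[OF that] dv d2[of u] du[of u] d[of u] x(2) by (auto simp: of_bool_def)
  then have capped: "capped V ?\<tau> H''" by (simp add: capped_def)
  (* The indicator at x records the unit gained there, the one at w the unit possibly lost there. *)
  have pt: "nat (?\<tau> u - int (deg H'' u)) + of_bool (u = x)
      \<le> nat (\<sigma> u - int (deg H u)) + of_bool (u = w)" for u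
  proof (cases "u = v")
    case True
    then show ?thesis using dv d[of v] x(2) l(1) by (auto simp: of_bool_def)
  next
    case False
    then show ?thesis
      using d2[of u] du[of u] d[of u] x(2) out[of u] B_deg_eq[of u] xB
      by (auto simp: of_bool_def split: if_splits)
  qed
  have "deficiency V ?\<tau> H'' + (\<Sum>u\<in>V. of_bool (u = x))
      \<le> deficiency V \<sigma> H + (\<Sum>u\<in>V. of_bool (u = w))"
    unfolding deficiency_def sum.distrib[symmetric] by (rule sum_mono) (use pt in auto)
  moreover have "(\<Sum>u\<in>V. of_bool (u = x)) = (1::nat)"
    using x(1) A_sub finite_V by (auto simp: of_bool_def sum.delta)
  moreover have "(\<Sum>u\<in>V. of_bool (u = w)) \<le> (1::nat)"
    using finite_V by (auto simp: of_bool_def sum.delta)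
  ultimately have "deficiency V ?\<tau> H'' \<le> deficiency V \<sigma> H" by linarith
  moreover have "H'' \<subseteq> E" using H' by (auto simp: H''_def)
  ultimately show ?thesis using capped by blast
qed

text \<open>
  First exchange a path to \<open>v\<close>, which serves a deficient vertex \<open>x\<close> and brings the degree of \<open>v\<close> to
  \<open>\<sigma> v + 2 \<le> h + 1\<close>. Then join \<open>v\<close> to further vertices of \<open>A\<close> until its degree is at least \<open>h\<close>. Each
  of them can take one more edge; this includes \<open>x\<close>, whose degree is still at most its target.
\<close>

lemma raise_target:
  assumes v: "v \<in> B" and h: "\<sigma> v < h" and many: "h \<le> int (deg K v)"
  shows "\<exists>H'. H' \<subseteq> E \<and> capped V (\<sigma>(v := h)) H' \<and>
    deficiency V (\<sigma>(v := h)) H' < deficiency V \<sigma> H"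
proof -
  obtain x H' where x: "x \<in> A" "int (deg H x) < \<sigma> x" and H': "H' \<subseteq> E"
    and d: "\<And>u. int (deg H' u) = int (deg H u) + of_bool (u = x) + of_bool (u = v)"
    using shift_to_B[OF v] by blast
  have fin: "finite H'" and finK: "finite K" using H' K_sub by (auto intro: finite_sub_E)
  define R where "R = {e \<in> K - H'. v \<in> e}"
  have "deg K v = card R + deg (K \<inter> H') v"
    using deg_Diff[of K "K \<inter> H'" v] finK by (simp add: Diff_Int deg_def R_def)
  moreover have "deg (K \<inter> H') v \<le> deg H' v" by (rule deg_mono) (use fin in auto)
  ultimately have "nat (h - int (deg H' v)) \<le> card R" using many by linarith
  then obtain D where D: "D \<subseteq> R" "card D = nat (h - int (deg H' v))"
    by (rule obtain_subset_with_card_n)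
  have DE: "D \<subseteq> E" "D \<inter> H' = {}" using D(1) K_sub by (auto simp: R_def)
  have star: "e \<in> D \<Longrightarrow> v \<in> e \<and> card e = 2" for e
    using D(1) DE edge_card by (auto simp: R_def)
  define H'' where "H'' = H' \<union> D"
  have d2: "int (deg H'' u) = int (deg H' u) + int (deg D u)" for u
    using deg_Un_disjoint[of H' D u] fin finite_sub_E[OF DE(1)] DE(2)
    by (simp add: H''_def Int_commute)
  have xv: "x \<noteq> v" using x v A_B_disjoint by auto
  have "int (deg H' v) = \<sigma> v + 2" using d[of v] xv B_deg_eq[OF v] by simp
  then have dv: "h \<le> int (deg H'' v)" "int (deg H'' v) \<le> h + 1"
    using d2[of v] deg_star_centre[of D v] star D(2) h by auto
  have du: "int (deg D u) = of_bool ({v, u} \<in> D)" if "u \<noteq> v" for u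
    using deg_star_leaf[of D v u] star that by auto
  have inA: "{v, u} \<in> D \<Longrightarrow> u \<in> A" for u
    using D(1) v A_B_disjoint by (auto simp: R_def K_def)
  let ?\<tau> = "\<sigma>(v := h)"
  have cap: "\<And>u. u \<in> V \<Longrightarrow> int (deg H u) \<le> \<sigma> u + 1"
    using H_capped by (auto simp: capped_def)
  have "int (deg H'' u) \<le> ?\<tau> u + 1" if "u \<in> V" for u
    using cap[OF that] dv d2[of u] du[of u] d[of u] x(2) inA[of u] A_deg_le[of u]
    by (auto simp: of_bool_def)
  then have capped: "capped V ?\<tau> H''" by (simp add: capped_def)
  have "nat (?\<tau> u - int (deg H'' u)) \<le> nat (\<sigma> u - int (deg H u))" for u
    using dv d2[of u] du[of u] d[of u] by (auto simp: of_bool_def)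
  moreover have "nat (?\<tau> x - int (deg H'' x)) < nat (\<sigma> x - int (deg H x))"
    using xv d2[of x] d[of x] x(2) by (auto simp: of_bool_def)
  ultimately have "deficiency V ?\<tau> H'' < deficiency V \<sigma> H"
    unfolding deficiency_def using x(1) A_sub
    by (intro sum_strict_mono_ex1[OF finite_V]) blast+
  moreover have "H'' \<subseteq> E" using H' DE by (auto simp: H''_def)
  ultimately show ?thesis using capped by blast
qed


section \<open>Counting across the alternating classes\<close>

text \<open>
  Both sums are compared with the number of edges of \<open>H \<inter> K\<close>. All edges of \<open>H\<close> at a vertex of \<open>B\<close>
  lie in \<open>K\<close>, and all edges outside \<open>K\<close> at a vertex of \<open>A\<close> lie in \<open>H\<close>. Strictness comes from a
  deficient vertex, which belongs to \<open>A\<close> by the path of length 0.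
\<close>

lemma deficient_balance:
  assumes "deficiency V \<sigma> H \<noteq> 0"
  shows "(\<Sum>v\<in>B. \<sigma> v + 1) < (\<Sum>v\<in>A. \<sigma> v - int (deg (E - K) v))"
proof -
  obtain x where x: "x \<in> V" "int (deg H x) < \<sigma> x"
    using assms finite_V by (auto simp: deficiency_def)
  then have xA: "x \<in> A" unfolding A_def using start by blast
  have finH: "finite H" using H_sub by (rule finite_sub_E)
  have Bv: "\<sigma> v + 1 = int (deg (H \<inter> K) v)" if "v \<in> B" for v
  proof -
    have "{e \<in> H. v \<in> e} = {e \<in> H \<inter> K. v \<in> e}"
      using that B_closed H_sub by (auto simp: K_def elim!: edge_at[of _ v])
    then show ?thesis using B_deg_eq[OF that] by (simp add: deg_def)
  qed
  have Av: "int (deg (H \<inter> K) v) + int (deg (E - K) v) = int (deg H v)" if "v \<in> A" for v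
  proof -
    have "e \<in> H" if e: "e \<in> E - K" "v \<in> e" for e
    proof -
      obtain w where w: "e = {v, w}" using edge_at e by blast
      then have "w \<notin> B" using e \<open>v \<in> A\<close> by (auto simp: K_def)
      then show ?thesis using A_closed[OF \<open>v \<in> A\<close>, of w] e w by auto
    qed
    then have "{e \<in> E - K. v \<in> e} = {e \<in> H - H \<inter> K. v \<in> e}" using H_sub by auto
    then have "deg (E - K) v = deg (H - H \<inter> K) v" by (simp add: deg_def)
    then show ?thesis using deg_Diff[of H "H \<inter> K" v] finH by simp
  qed
  have fin: "finite A" using A_sub finite_V finite_subset by blast
  have "(\<Sum>v\<in>B. \<sigma> v + 1) = int (\<Sum>v\<in>B. deg (H \<inter> K) v)" using Bv by simp
  also have "\<dots> = int (\<Sum>v\<in>A. deg (H \<inter> K) v)" by (simp only: sum_deg_K[OF Int_lower2])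
  also have "\<dots> = (\<Sum>v\<in>A. int (deg (H \<inter> K) v))" by simp
  also have "\<dots> < (\<Sum>v\<in>A. \<sigma> v - int (deg (E - K) v))"
  proof (rule sum_strict_mono_ex1[OF fin])
    show "\<forall>v\<in>A. int (deg (H \<inter> K) v) \<le> \<sigma> v - int (deg (E - K) v)"
      using Av A_deg_le by fastforce
    show "\<exists>v\<in>A. int (deg (H \<inter> K) v) < \<sigma> v - int (deg (E - K) v)"
      using Av[OF xA] x xA by (intro bexI[of _ x]) auto
  qed
  finally show ?thesis .
qed

text \<open>
  The two assumptions say that giving each edge of \<open>K\<close> the weight \<open>c\<close> separates the two sides of
  \<open>deficient_balance\<close> in the wrong order.
\<close>

lemma no_deficiency_if_fractional:
  fixes c :: real
  assumes lowB: "\<And>v. v \<in> B \<Longrightarrow> c * real (deg K v) \<le> real_of_int (\<sigma> v) + 1"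
    and upA: "\<And>v. v \<in> A \<Longrightarrow>
      real_of_int (\<sigma> v) - real (deg (E - K) v) \<le> c * real (deg K v)"
  shows "deficiency V \<sigma> H = 0"
proof (rule ccontr)
  assume deficient: "deficiency V \<sigma> H \<noteq> 0"
  have "real_of_int (\<Sum>v\<in>B. \<sigma> v + 1)
      < real_of_int (\<Sum>v\<in>A. \<sigma> v - int (deg (E - K) v))"
    using deficient_balance[OF deficient] of_int_less_iff by blast
  moreover have "real_of_int (\<Sum>v\<in>A. \<sigma> v - int (deg (E - K) v)) \<le> c * real (card K)"
    unfolding sum_deg_K(1)[OF order_refl, symmetric]
    by (simp add: sum_distrib_left) (use upA in \<open>auto intro: sum_mono\<close>)
  moreover have "c * real (card K) \<le> real_of_int (\<Sum>v\<in>B. \<sigma> v + 1)"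
    unfolding sum_deg_K(2)[OF order_refl, symmetric]
    by (simp add: sum_distrib_left) (use lowB in \<open>auto intro: sum_mono\<close>)
  ultimately show False by linarith
qed

end


section \<open>The degree factor\<close>

theorem theorem2p7:
  fixes G :: "'a graph" and c :: real
    and am ap :: "'a \<Rightarrow> int" and L :: "'a \<Rightarrow> nat set"
  assumes "finite_simple_graph G"
    and "0 < c" and "c < 2/3"
    and "\<And>v. v \<in> verts G \<Longrightarrow> real_of_int (am v) \<le> c * real (degree G v)"
    and "\<And>v. v \<in> verts G \<Longrightarrow> c * real (degree G v) \<le> real_of_int (ap v)"
    and "\<And>v. v \<in> verts G \<Longrightarrow> ap v < int (degree G v)"
    and "\<And>v. v \<in> verts G \<Longrightarrow>
           real_of_int (ap v) \<le>
             min (c * real (degree G v) + (1 - c) * real_of_int (am v) + 1)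
                 ((real_of_int (am v) + 1) / c + 1)"
    and "\<And>v. v \<in> verts G \<Longrightarrow>
           L v = {k. int k \<in> {am v, am v + 1, ap v, ap v + 1}}"
  shows "\<exists>H. L_factor G L H"
proof -
  define V where "V = verts G"
  define E where "E = edges G"
  have degG: "degree G v = deg E v" for v by (simp add: degree_def deg_def E_def)
  note am_le = assms(4)[unfolded degG, folded V_def]
    and le_ap = assms(5)[unfolded degG, folded V_def]
    and bounds = assms(7)[unfolded degG, folded V_def]
  have finV: "finite V" and edge: "\<And>e. e \<in> E \<Longrightarrow> e \<subseteq> V \<and> card e = 2"
    using assms(1) by (auto simp: finite_simple_graph_def V_def E_def)
  (* A target of - 1 is possible; the pair of admissible degrees then still contains 0. *)
  have am_ge: "- 1 \<le> am v" if "v \<in> V" for v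
  proof -
    have "0 \<le> real_of_int (ap v)" using le_ap[OF that] assms(2)
      by (smt (verit) mult_nonneg_nonneg of_nat_0_le_iff)
    then have "0 \<le> ((real_of_int (am v) + 1) / c + 1) * c"
      using bounds[OF that] assms(2) by (intro mult_nonneg_nonneg) auto
    also have "\<dots> = real_of_int (am v) + 1 + c" using assms(2) by (simp add: field_simps)
    finally show ?thesis using assms(3) by linarith
  qed
  define ok where "ok = (\<lambda>(\<sigma>, H).
    (\<forall>v\<in>V. \<sigma> v = am v \<or> \<sigma> v = ap v) \<and> H \<subseteq> E \<and> capped V \<sigma> H)"
  define raised where "raised = (\<lambda>\<sigma>. card {v\<in>V. \<sigma> v \<noteq> am v})"
  (* The factor card V + 1 exceeds every value of raised, so cost orders pairs lexicographically. *)
  define cost where "cost = (\<lambda>(\<sigma>, H). (card V + 1) * deficiency V \<sigma> H + raised \<sigma>)"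
  have "0 \<le> am v + 1" if "v \<in> V" for v using am_ge[OF that] by simp
  then have "ok (am, {})" by (simp add: ok_def capped_def deg_def)
  then obtain \<sigma> H where sH: "ok (\<sigma>, H)"
      and least: "\<And>\<tau> H'. ok (\<tau>, H') \<Longrightarrow> cost (\<sigma>, H) \<le> cost (\<tau>, H')"
    using ex_has_least_nat[of ok "(am, {})" cost] by (metis surj_pair)
  have raised_le: "raised \<tau> \<le> card V" for \<tau>
    unfolding raised_def by (rule card_mono) (use finV in auto)
  have def_min: "deficiency V \<sigma> H \<le> deficiency V \<tau> H'" if "ok (\<tau>, H')" for \<tau> H'
  proof (rule ccontr)
    assume "\<not> ?thesis"
    then have "(card V + 1) * (deficiency V \<tau> H' + 1) \<le> (card V + 1) * deficiency V \<sigma> H"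
      by (intro mult_le_mono2) simp
    then have "cost (\<tau>, H') < cost (\<sigma>, H)" using raised_le[of \<tau>] by (simp add: cost_def)
    then show False using least[OF that] by simp
  qed
  have choice: "\<And>v. v \<in> V \<Longrightarrow> \<sigma> v = am v \<or> \<sigma> v = ap v"
    and HE: "H \<subseteq> E" and Hcap: "capped V \<sigma> H" using sH by (auto simp: ok_def)
  interpret min_deficiency V E H \<sigma>
    by unfold_locales (use finV edge HE Hcap choice def_min in \<open>auto simp: ok_def\<close>)
  have deg_split: "real (deg E v) = real (deg (E - K) v) + real (deg K v)" for v
    using deg_Diff[OF finite_E K_sub, of v] by linarith
  have "deficiency V \<sigma> H = 0"
  proof (rule no_deficiency_if_fractional[of c])
    fix v assume vB: "v \<in> B"
    then have vV: "v \<in> V" using B_sub by auto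
    show "c * real (deg K v) \<le> real_of_int (\<sigma> v) + 1"
    proof (cases "\<sigma> v = ap v")
      case True
      have "c * real (deg K v) \<le> c * real (deg E v)"
        using deg_split[of v] assms(2) by (intro mult_left_mono) auto
      then show ?thesis using le_ap[OF vV] True by simp
    next
      case False
      then have am: "\<sigma> v = am v" "am v \<noteq> ap v" using choice[OF vV] by auto
      then have lt: "am v < ap v" using am_le[OF vV] le_ap[OF vV] by linarith
      have "\<not> ap v \<le> int (deg K v)"
      proof
        assume "ap v \<le> int (deg K v)"
        then obtain H' where "H' \<subseteq> E" "capped V (\<sigma>(v := ap v)) H'"
            "deficiency V (\<sigma>(v := ap v)) H' < deficiency V \<sigma> H"
          using raise_target[OF vB] am lt by auto
        moreover from this have "ok (\<sigma>(v := ap v), H')" using choice by (auto simp: ok_def)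
        ultimately show False using def_min by fastforce
      qed
      then have "real (deg K v) \<le> real_of_int (ap v) - 1" by linarith
      also have "\<dots> \<le> (real_of_int (am v) + 1) / c" using bounds[OF vV] by simp
      finally show ?thesis using assms(2) am(1) by (simp add: field_simps)
    qed
  next
    fix v assume vA: "v \<in> A"
    then have vV: "v \<in> V" using A_sub by auto
    let ?q = "real (deg (E - K) v)"
    show "real_of_int (\<sigma> v) - ?q \<le> c * real (deg K v)"
    proof (cases "\<sigma> v = am v")
      case True
      have "c * ?q \<le> 1 * ?q" using assms(2,3) by (intro mult_right_mono) auto
      then show ?thesis using am_le[OF vV] True by (simp add: deg_split algebra_simps)
    next
      case False
      then have ap: "\<sigma> v = ap v" "am v \<noteq> ap v" using choice[OF vV] by auto
      then have lt: "am v < ap v" using am_le[OF vV] le_ap[OF vV] by linarith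
      have "\<not> int (deg (E - K) v) \<le> am v + 2"
      proof
        assume "int (deg (E - K) v) \<le> am v + 2"
        then obtain H' where H': "H' \<subseteq> E" "capped V (\<sigma>(v := am v)) H'"
            "deficiency V (\<sigma>(v := am v)) H' \<le> deficiency V \<sigma> H"
          using lower_target[OF vA, of "am v"] ap lt am_ge[OF vV] by auto
        then have "ok (\<sigma>(v := am v), H')" using choice by (auto simp: ok_def)
        then have "cost (\<sigma>, H) \<le> cost (\<sigma>(v := am v), H')" by (rule least)
        moreover have "raised (\<sigma>(v := am v)) < raised \<sigma>"
          unfolding raised_def
          by (rule psubset_card_mono) (use finV vV False in \<open>auto split: if_splits\<close>)
        moreover have "(card V + 1) * deficiency V (\<sigma>(v := am v)) H'
            \<le> (card V + 1) * deficiency V \<sigma> H" using H'(3) by (rule mult_le_mono2)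
        ultimately show False by (simp add: cost_def)
      qed
      then have "real_of_int (am v) + 3 \<le> ?q" by linarith
      then have "(1 - c) * (real_of_int (am v) + 3) \<le> (1 - c) * ?q"
        using assms(3) by (intro mult_left_mono) auto
      moreover have "real_of_int (ap v)
          \<le> c * (?q + real (deg K v)) + (1 - c) * real_of_int (am v) + 1"
        using bounds[OF vV] deg_split[of v] by simp
      ultimately show ?thesis using ap(1) assms(3) by (simp add: algebra_simps)
    qed
  qed
  then have "int (deg H v) \<in> {\<sigma> v, \<sigma> v + 1}" if "v \<in> V" for v
    using Hcap that finV by (force simp: deficiency_def capped_def)
  then have "int (deg H v) \<in> {am v, am v + 1, ap v, ap v + 1}" if "v \<in> V" for v
    using that choice[OF that] by force
  moreover have "degree (V, H) v = deg H v" for v by (simp add: degree_def deg_def)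
  moreover have "\<forall>e\<in>H. e \<subseteq> V \<and> card e = 2" using HE edge by blast
  ultimately have "L_factor G L (V, H)"
    unfolding L_factor_def spanning_subgraph_def finite_simple_graph_def
    using assms(8) HE finV by (simp add: V_def E_def)
  then show ?thesis ..
qed

end
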